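(* Let $\mathcal H_1$ be a finite dimensional complex Hilbert space and let $Z$ be a CAR field over $\mathcal H_1$ acting irreducibly on a Hilbert space $\mathscr K$. Then the complex linear span of the set $\mathfrak S_{GIG}$ of (density matrices of) gauge invariant Gaussian states is all of the Araki-Wyss algebra $\mathscr G_{\mathcal H_1}$.
   Context: Let $N=\dim\mathcal H_1$; inner products are conjugate linear in the first variable. A CAR field over $\mathcal H_1$ is a conjugate linear map $\psi\mapsto Z(\psi)$ from $\mathcal H_1$ into the bounded operators on a Hilbert space $\mathscr K$ such that, with $Z^*(\psi):=Z(\psi)^*$, $Z(\psi)Z^*(\phi)+Z^*(\phi)Z(\psi)=\langle\psi,\phi\rangle 1$ and $Z(\psi)Z(\phi)+Z(\phi)Z(\psi)=0$ for all $\psi,\phi\in\mathcal H_1$. When $Z$ acts irreducibly, $\dim\mathscr K=2^N$ and the $*$-algebra $\mathscr A_{\mathcal H_1}$ generated by the $Z(\psi)$ is $\mathcal B(\mathscr K)$. The normalized trace is $\tau(A)=2^{-N}\mathrm{Tr}[A]$. Density matrices are taken with respect to $\tau$: a state $\rho$ on $\mathscr A_{\mathcal H_1}$ is identified with the operator $\rho\ge 0$, $\tau(\rho)=1$, such that the state is $A\mapsto\tau(A\rho)$. Let $\mathscr Q=\{Q\in\mathcal B(\mathcal H_1): 0\le Q\le 1\}$. For $Q\in\mathscr Q$ with spectral decomposition $Q=\sum_{j=1}^N\mu_j|\psi_j\rangle\langle\psi_j|$ ($\{\psi_j\}$ orthonormal), put $\rho_Q=\prod_{j=1}^N\big((1-\mu_j)2Z(\psi_j)Z^*(\psi_j)+\mu_j2Z^*(\psi_j)Z(\psi_j)\big)$.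 This is the density matrix of the unique state $\rho$ with $\rho(Z^*(\psi_1)\cdots Z^*(\psi_m)Z(\phi_n)\cdots Z(\phi_1))=\delta_{m,n}\det(\langle\phi_j,Q\psi_k\rangle)$; such states are called gauge invariant Gaussian states with symbol $Q$, and $\mathfrak S_{GIG}=\{\rho_Q:Q\in\mathscr Q\}$. The number operator is $\mathcal N=\sum_{j=1}^N Z^*(\psi_j)Z(\psi_j)$ for any orthonormal basis $\{\psi_j\}$ of $\mathcal H_1$, and the Araki-Wyss algebra $\mathscr G_{\mathcal H_1}$ is the commutant of $\mathcal N$ in $\mathscr A_{\mathcal H_1}$. *)

theory Defs
  imports "HOL-Analysis.Analysis"
begin

section \<open>Complex Hilbert spaces\<close>

class scaleC =
  fixes scaleC :: "complex \<Rightarrow> 'a \<Rightarrow> 'a"  (infixr "*\<^sub>C" 75)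

class complex_vector = scaleC + ab_group_add +
  assumes scaleC_add_right: "a *\<^sub>C (x + y) = a *\<^sub>C x + a *\<^sub>C y"
    and scaleC_add_left: "(a + b) *\<^sub>C x = a *\<^sub>C x + b *\<^sub>C x"
    and scaleC_scaleC: "a *\<^sub>C b *\<^sub>C x = (a * b) *\<^sub>C x"
    and scaleC_one: "1 *\<^sub>C x = x"

global_interpretation complex_vector:
  vector_space "scaleC :: complex \<Rightarrow> 'a \<Rightarrow> 'a :: complex_vector"
  defines csubspace_raw_def: csubspace = complex_vector.subspace
    and cspan_raw_def: cspan = complex_vector.span
    and cdependent_raw_def: cdependent = complex_vector.dependent
    and cdim_raw_def: cdim = complex_vector.dim
  by unfold_locales
    (auto simp: scaleC_add_right scaleC_add_left scaleC_scaleC scaleC_one)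

text \<open>The inner product is conjugate linear in the first variable; the norm, metric and
  topology are those of the underlying real normed space and are induced by it.\<close>

class complex_inner = real_normed_vector + complex_vector +
  fixes cinner :: "'a \<Rightarrow> 'a \<Rightarrow> complex"
  assumes scaleR_scaleC: "r *\<^sub>R x = complex_of_real r *\<^sub>C x"
    and cinner_commute: "cinner x y = cnj (cinner y x)"
    and cinner_add_right: "cinner x (y + z) = cinner x y + cinner x z"
    and cinner_scaleC_right: "cinner x (c *\<^sub>C y) = c * cinner x y"
    and cinner_self_nonneg: "cinner x x \<in> \<real>\<^sub>\<ge>\<^sub>0"
    and cinner_self_eq_0: "cinner x x = 0 \<longleftrightarrow> x = 0"
    and norm_eq_sqrt_cinner: "norm x = sqrt (Re (cinner x x))"

class chilbert_space = complex_inner + complete_space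

definition finite_dimensional :: "'a::complex_vector itself \<Rightarrow> bool" where
  "finite_dimensional _ \<longleftrightarrow> (\<exists>B :: 'a set. finite B \<and> cspan B = UNIV)"

text \<open>Indices run over \<open>0, \<dots>, N - 1\<close>; in finite dimension \<open>N\<close> such vectors span the space.\<close>

definition orthonormal_basis :: "(nat \<Rightarrow> 'a::complex_inner) \<Rightarrow> bool" where
  "orthonormal_basis \<psi> \<longleftrightarrow>
    (\<forall>i < cdim (UNIV :: 'a set). \<forall>j < cdim (UNIV :: 'a set).
      cinner (\<psi> i) (\<psi> j) = (if i = j then 1 else 0))"


section \<open>Bounded operators\<close>

typedef (overloaded) 'a bop =
  "{f :: 'a::complex_inner \<Rightarrow> 'a. bounded_linear f \<and> (\<forall>c x. f (c *\<^sub>C x) = c *\<^sub>C f x)}"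
  morphisms app_op Bop
proof
  show "(\<lambda>x. 0) \<in> {f :: 'a \<Rightarrow> 'a. bounded_linear f \<and> (\<forall>c x. f (c *\<^sub>C x) = c *\<^sub>C f x)}"
    by (simp add: bounded_linear_zero)
qed

setup_lifting type_definition_bop

lemma norm_scaleC: "norm (c *\<^sub>C x) = cmod c * norm (x :: 'a::complex_inner)"
proof -
  have "cinner (c *\<^sub>C x) (c *\<^sub>C x) = c * cnj c * cinner x x"
    using cinner_commute[of "c *\<^sub>C x" x] cinner_commute[of x x]
    by (simp add: cinner_scaleC_right)
  then have "Re (cinner (c *\<^sub>C x) (c *\<^sub>C x)) = (cmod c)\<^sup>2 * Re (cinner x x)"
    by (simp add: complex_mult_cnj cmod_power2 flip: of_real_power of_real_add)
  then show ?thesis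
    by (simp add: norm_eq_sqrt_cinner real_sqrt_mult)
qed

lemma bounded_linear_scaleC: "bounded_linear (\<lambda>x :: 'a::complex_inner. c *\<^sub>C x)"
  by (rule bounded_linear_intro[where K = "cmod c"])
    (simp_all add: scaleC_add_right scaleR_scaleC scaleC_scaleC norm_scaleC mult.commute)

text \<open>Multiplication is composition. The type is not a \<open>ring_1\<close>, since \<open>0 = 1\<close> on the
  zero space.\<close>

instantiation bop :: (complex_inner) "{ring, monoid_mult, complex_vector}"
begin

lift_definition zero_bop :: "'a bop" is "\<lambda>x. 0"
  by (simp add: bounded_linear_zero)
lift_definition one_bop :: "'a bop" is "\<lambda>x. x"
  by (simp add: bounded_linear_ident)
lift_definition plus_bop :: "'a bop \<Rightarrow> 'a bop \<Rightarrow> 'a bop" is "\<lambda>f g x. f x + g x"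
  by (simp add: bounded_linear_add scaleC_add_right)
lift_definition minus_bop :: "'a bop \<Rightarrow> 'a bop \<Rightarrow> 'a bop" is "\<lambda>f g x. f x - g x"
  by (simp add: bounded_linear_sub complex_vector.scale_right_diff_distrib)
lift_definition uminus_bop :: "'a bop \<Rightarrow> 'a bop" is "\<lambda>f x. - f x"
  by (simp add: bounded_linear_minus)
lift_definition times_bop :: "'a bop \<Rightarrow> 'a bop \<Rightarrow> 'a bop" is "\<lambda>f g x. f (g x)"
  by (simp add: bounded_linear_compose)
lift_definition scaleC_bop :: "complex \<Rightarrow> 'a bop \<Rightarrow> 'a bop" is "\<lambda>c f x. c *\<^sub>C f x"
  by (auto simp: bounded_linear_compose[OF bounded_linear_scaleC] scaleC_scaleC mult.commute)

instance
  by standard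
    (transfer; auto simp: fun_eq_iff scaleC_add_right scaleC_add_left scaleC_scaleC scaleC_one
      bounded_linear.linear linear_add)+

end

text \<open>For bounded operators on a Hilbert space the adjoint exists and is unique.\<close>

definition adj :: "'a::chilbert_space bop \<Rightarrow> 'a bop"  ("_\<^sup>\<star>" [1000] 999) where
  "A\<^sup>\<star> = (THE B. \<forall>x y. cinner (app_op B x) y = cinner x (app_op A y))"

definition positive_op :: "'a::complex_inner bop \<Rightarrow> bool" where
  "positive_op A \<longleftrightarrow> (\<forall>x. cinner x (app_op A x) \<in> \<real>\<^sub>\<ge>\<^sub>0)"

inductive_set star_algebra :: "'a::chilbert_space bop set \<Rightarrow> 'a bop set" for S where
  generator: "A \<in> S \<Longrightarrow> A \<in> star_algebra S"
| one: "1 \<in> star_algebra S"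
| add: "A \<in> star_algebra S \<Longrightarrow> B \<in> star_algebra S \<Longrightarrow> A + B \<in> star_algebra S"
| scale: "A \<in> star_algebra S \<Longrightarrow> c *\<^sub>C A \<in> star_algebra S"
| mult: "A \<in> star_algebra S \<Longrightarrow> B \<in> star_algebra S \<Longrightarrow> A * B \<in> star_algebra S"
| adjoint: "A \<in> star_algebra S \<Longrightarrow> A\<^sup>\<star> \<in> star_algebra S"


section \<open>CAR fields\<close>

definition CAR_field :: "('h::chilbert_space \<Rightarrow> 'k::chilbert_space bop) \<Rightarrow> bool" where
  "CAR_field Z \<longleftrightarrow>
    (\<forall>\<psi> \<phi>. Z (\<psi> + \<phi>) = Z \<psi> + Z \<phi>) \<and>
    (\<forall>c \<psi>. Z (c *\<^sub>C \<psi>) = cnj c *\<^sub>C Z \<psi>) \<and>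
    (\<forall>\<psi> \<phi>. Z \<psi> * (Z \<phi>)\<^sup>\<star> + (Z \<phi>)\<^sup>\<star> * Z \<psi> = cinner \<psi> \<phi> *\<^sub>C 1) \<and>
    (\<forall>\<psi> \<phi>. Z \<psi> * Z \<phi> + Z \<phi> * Z \<psi> = 0)"

definition acts_irreducibly :: "('h::chilbert_space \<Rightarrow> 'k::chilbert_space bop) \<Rightarrow> bool" where
  "acts_irreducibly Z \<longleftrightarrow>
    (UNIV :: 'k set) \<noteq> {0} \<and>
    (\<forall>M :: 'k set. csubspace M \<and> closed M \<and>
        (\<forall>\<psi>. \<forall>x \<in> M. app_op (Z \<psi>) x \<in> M \<and> app_op ((Z \<psi>)\<^sup>\<star>) x \<in> M)
      \<longrightarrow> M = {0} \<or> M = UNIV)"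

definition CAR_algebra :: "('h::chilbert_space \<Rightarrow> 'k::chilbert_space bop) \<Rightarrow> 'k bop set" where
  "CAR_algebra Z = star_algebra (range Z)"

text \<open>The value does not depend on which orthonormal basis is chosen.\<close>

definition number_operator :: "('h::chilbert_space \<Rightarrow> 'k::chilbert_space bop) \<Rightarrow> 'k bop" where
  "number_operator Z =
    (let \<psi> = (SOME \<psi> :: nat \<Rightarrow> 'h. orthonormal_basis \<psi>)
     in \<Sum>j < cdim (UNIV :: 'h set). (Z (\<psi> j))\<^sup>\<star> * Z (\<psi> j))"

definition araki_wyss :: "('h::chilbert_space \<Rightarrow> 'k::chilbert_space bop) \<Rightarrow> 'k bop set" where
  "araki_wyss Z = {A \<in> CAR_algebra Z. A * number_operator Z = number_operator Z * A}"


section \<open>Gauge invariant Gaussian states\<close>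

definition symbols :: "'h::chilbert_space bop set" where
  "symbols = {Q. positive_op Q \<and> positive_op (1 - Q)}"

definition spectral_decomposition ::
  "'h::chilbert_space bop \<Rightarrow> (nat \<Rightarrow> real) \<Rightarrow> (nat \<Rightarrow> 'h) \<Rightarrow> bool" where
  "spectral_decomposition Q \<mu> \<psi> \<longleftrightarrow>
    orthonormal_basis \<psi> \<and>
    (\<forall>\<phi>. app_op Q \<phi> =
      (\<Sum>j < cdim (UNIV :: 'h set). (complex_of_real (\<mu> j) * cinner (\<psi> j) \<phi>) *\<^sub>C \<psi> j))"

text \<open>The density matrix, with respect to the normalized trace, of the state whose symbol has
  eigenvalues \<open>\<mu>\<close> and eigenvectors \<open>\<psi>\<close>. The factors commute with one another.\<close>

definition gaussian_density ::
  "('h::chilbert_space \<Rightarrow> 'k::chilbert_space bop) \<Rightarrow> (nat \<Rightarrow> real) \<Rightarrow> (nat \<Rightarrow> 'h) \<Rightarrow> 'k bop" where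
  "gaussian_density Z \<mu> \<psi> =
    prod_list (map (\<lambda>j.
        complex_of_real ((1 - \<mu> j) * 2) *\<^sub>C (Z (\<psi> j) * (Z (\<psi> j))\<^sup>\<star>) +
        complex_of_real (\<mu> j * 2) *\<^sub>C ((Z (\<psi> j))\<^sup>\<star> * Z (\<psi> j)))
      [0..<cdim (UNIV :: 'h set)])"

text \<open>A degenerate \<open>Q\<close> has several spectral decompositions, all giving the same density
  matrix.\<close>

definition GIG_states :: "('h::chilbert_space \<Rightarrow> 'k::chilbert_space bop) \<Rightarrow> 'k bop set" where
  "GIG_states Z =
    {gaussian_density Z \<mu> \<psi> |Q \<mu> \<psi>. Q \<in> symbols \<and> spectral_decomposition Q \<mu> \<psi>}"

end

theory Submission
  imports Defs
begin

text \<open>By the CAR every element of the algebra is a sum of normally ordered monomials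
  \<open>Z(v\<^sub>1)\<^sup>* \<cdots> Z(v\<^sub>m)\<^sup>* Z(w\<^sub>n) \<cdots> Z(w\<^sub>1)\<close>, and the commutator with the number operator multiplies such
  a monomial by \<open>m - n\<close>; eigenvectors for distinct eigenvalues being independent, the commutant
  consists of the combinations of monomials with \<open>m = n\<close>. Polarising each pair \<open>(v\<^sub>i, w\<^sub>i)\<close> reduces
  these to \<open>v\<^sub>i = w\<^sub>i\<close>, and Gram-Schmidt reduces further to orthonormal \<open>v\<^sub>i\<close>. In that case
  the monomial is the product of the \<open>Z(v\<^sub>i)\<^sup>* Z(v\<^sub>i)\<close>, a multiple of the Gaussian density whose symbol
  has eigenvalue \<open>1\<close> on the \<open>v\<^sub>i\<close> and \<open>1/2\<close> on their orthogonal complement.\<close>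


section \<open>Adjoints of bounded operators\<close>

lemma cinner_zero_right [simp]: "cinner x 0 = 0"
  using cinner_add_right[of x 0 0] by simp

lemma cinner_zero_left [simp]: "cinner 0 x = 0"
  using cinner_commute[of 0 x] by simp

lemma cinner_add_left: "cinner (x + y) z = cinner x z + cinner y z"
  by (metis cinner_commute cinner_add_right complex_cnj_add)

lemma cinner_scaleC_left: "cinner (c *\<^sub>C x) y = cnj c * cinner x y"
  by (metis cinner_commute cinner_scaleC_right complex_cnj_mult)

lemma cinner_minus_right [simp]: "cinner x (- y) = - cinner x y"
  using cinner_add_right[of x y "- y"] by (simp add: eq_neg_iff_add_eq_0 add.commute)

lemma cinner_minus_left [simp]: "cinner (- x) y = - cinner x y"
  using cinner_add_left[of x "- x" y] by (simp add: eq_neg_iff_add_eq_0 add.commute)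

lemma cinner_diff_right: "cinner x (y - z) = cinner x y - cinner x z"
  using cinner_add_right[of x y "- z"] by simp

lemma cinner_diff_left: "cinner (x - y) z = cinner x z - cinner y z"
  using cinner_add_left[of x "- y" z] by simp

lemma cinner_sum_right: "cinner x (\<Sum>i\<in>I. f i) = (\<Sum>i\<in>I. cinner x (f i))"
  by (induction I rule: infinite_finite_induct) (auto simp: cinner_add_right)

lemma cinner_self: "cinner x x = complex_of_real ((norm x)\<^sup>2)"
proof -
  obtain r where r: "r \<ge> 0" "cinner x x = complex_of_real r"
    using cinner_self_nonneg[of x] by (auto elim!: nonneg_Reals_cases)
  then show ?thesis by (simp add: norm_eq_sqrt_cinner)
qed

lemma cinner_left_eqI:
  assumes "\<And>z. cinner x z = cinner y z"
  shows "x = y"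
proof -
  have "cinner (x - y) (x - y) = 0"
    using assms by (simp add: cinner_diff_left)
  then show ?thesis by (simp add: cinner_self_eq_0)
qed

lemma power2_norm_add: "(norm (x + y))\<^sup>2 = (norm x)\<^sup>2 + (norm y)\<^sup>2 + 2 * Re (cinner x y)"
proof -
  have "cinner (x + y) (x + y) = cinner x x + cinner y y + (cinner x y + cnj (cinner x y))"
    using cinner_commute[of y x] by (simp add: cinner_add_left cinner_add_right)
  then have "Re (cinner (x + y) (x + y)) = Re (cinner x x) + Re (cinner y y) + 2 * Re (cinner x y)"
    by simp
  then show ?thesis unfolding cinner_self by simp
qed

text \<open>Cauchy-Schwarz from the triangle inequality: expanding the square of
  \<open>norm (x + z)\<close> bounds the real part, and \<open>z\<close> is then taken to be the
  unimodular multiple of \<open>y\<close> that makes the inner product real and nonnegative.\<close>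

lemma norm_cinner_le: "cmod (cinner x y) \<le> norm x * norm y"
proof (cases "cinner x y = 0")
  case False
  have re: "Re (cinner x z) \<le> norm x * norm z" for z
  proof -
    have "(norm (x + z))\<^sup>2 \<le> (norm x + norm z)\<^sup>2"
      by (intro power_mono norm_triangle_ineq norm_ge_zero)
    then show ?thesis by (simp add: power2_norm_add power2_sum)
  qed
  define c where "c = cnj (cinner x y) / complex_of_real (cmod (cinner x y))"
  have c: "cmod c = 1" using False by (simp add: c_def norm_divide)
  have "c * cinner x y = complex_of_real (cmod (cinner x y))"
    using False complex_norm_square[of "cinner x y"]
    by (simp add: c_def field_simps power2_eq_square)
  then show ?thesis
    using re[of "c *\<^sub>C y"] c by (simp add: cinner_scaleC_right norm_scaleC)
qed simp

text \<open>The representing vector minimises \<open>\<parallel>x\<parallel>\<^sup>2 - 2 Re (f x)\<close>; by the parallelogram law every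
  minimising sequence is Cauchy.\<close>

lemma riesz:
  fixes f :: "'a::chilbert_space \<Rightarrow> complex"
  assumes add: "\<And>x y. f (x + y) = f x + f y"
    and scale: "\<And>c x. f (c *\<^sub>C x) = c * f x"
    and bound: "\<And>x. cmod (f x) \<le> K * norm x"
  shows "\<exists>z. \<forall>x. f x = cinner z x"
proof -
  define J where "J x = (norm x)\<^sup>2 - 2 * Re (f x)" for x
  have f_lin: "bounded_linear f"
    by (rule bounded_linear_intro[where K = K])
      (use bound in \<open>auto simp: add scale scaleR_scaleC scaleR_conv_of_real mult.commute\<close>)
  have contJ: "isCont J x" for x
    unfolding J_def
    by (intro continuous_intros bounded_linear.isCont[OF bounded_linear_compose[OF bounded_linear_Re f_lin]])
  have "J x \<ge> - K\<^sup>2" for x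
  proof -
    have "Re (f x) \<le> K * norm x"
      using bound[of x] complex_Re_le_cmod[of "f x"] by linarith
    moreover have "(norm x - K)\<^sup>2 \<ge> 0" by simp
    ultimately show ?thesis by (simp add: J_def power2_diff algebra_simps)
  qed
  then have bdd: "bdd_below (range J)" by (auto intro: bdd_belowI[where m = "- K\<^sup>2"])
  define m where "m = Inf (range J)"
  have m_le: "m \<le> J x" for x
    unfolding m_def by (intro cInf_lower bdd) auto
  have "\<exists>x. J x < m + inverse (real (Suc n))" for n
  proof -
    have "Inf (range J) < m + inverse (real (Suc n))" by (simp add: m_def)
    then show ?thesis using bdd by (subst (asm) cInf_less_iff) auto
  qed
  then obtain X where X: "J (X n) < m + inverse (real (Suc n))" for n by metis
  have par: "(norm (x - y))\<^sup>2 \<le> 2 * (J x - m) + 2 * (J y - m)" for x y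
  proof -
    have s: "f (x + y) = 2 * f ((1/2) *\<^sub>R (x + y))"
      by (simp add: scaleR_scaleC scale)
    have "(norm (x + y))\<^sup>2 = 4 * (norm ((1/2) *\<^sub>R (x + y)))\<^sup>2"
      by (simp add: power_mult_distrib power_divide)
    moreover have "(norm (x - y))\<^sup>2 + (norm (x + y))\<^sup>2 = 2 * (norm x)\<^sup>2 + 2 * (norm y)\<^sup>2"
      using power2_norm_add[of x "- y"] by (simp add: power2_norm_add)
    ultimately have "(norm (x - y))\<^sup>2 = 2 * J x + 2 * J y - 4 * J ((1/2) *\<^sub>R (x + y))"
      using arg_cong[OF s, of Re] by (simp add: J_def add)
    then show ?thesis using m_le[of "(1/2) *\<^sub>R (x + y)"] by simp
  qed
  have "Cauchy X"
  proof (rule metric_CauchyI)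
    fix e :: real assume "e > 0"
    then obtain M where M: "inverse (real (Suc M)) < e\<^sup>2 / 4"
      using reals_Archimedean[of "e\<^sup>2 / 4"] by auto
    have small: "J (X k) - m < e\<^sup>2 / 4" if "k \<ge> M" for k
    proof -
      have "inverse (real (Suc k)) \<le> inverse (real (Suc M))" using that by simp
      then show ?thesis using X[of k] M by linarith
    qed
    have "dist (X k) (X l) < e" if "k \<ge> M" "l \<ge> M" for k l
    proof -
      have "(dist (X k) (X l))\<^sup>2 < e\<^sup>2"
        using par[of "X k" "X l"] small[OF that(1)] small[OF that(2)] by (simp add: dist_norm)
      then show ?thesis using \<open>e > 0\<close> power_less_imp_less_base by fastforce
    qed
    then show "\<exists>M. \<forall>k\<ge>M. \<forall>l\<ge>M. dist (X k) (X l) < e" by blast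
  qed
  then obtain z where z: "X \<longlonglongrightarrow> z" using Cauchy_convergent_iff convergent_def by blast
  have lim: "(\<lambda>n. J (X n)) \<longlonglongrightarrow> J z" using contJ z isCont_tendsto_compose by blast
  have "(\<lambda>n. m + inverse (real (Suc n))) \<longlonglongrightarrow> m + 0"
    by (intro tendsto_intros LIMSEQ_inverse_real_of_nat)
  then have Jz: "J z \<le> m"
    using LIMSEQ_le[OF lim] X by (auto simp: less_imp_le)
  have re: "Re (f h) = Re (cinner z h)" for h
  proof -
    define d where "d = Re (cinner z h) - Re (f h)"
    \<comment> \<open>Minimality of \<open>z\<close> along the real line through \<open>z\<close> in
      direction \<open>h\<close>. A quadratic in \<open>t\<close> without constant term that is
      nonnegative everywhere has vanishing linear coefficient.\<close>
    have q: "0 \<le> t\<^sup>2 * (norm h)\<^sup>2 + 2 * t * d" for t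
    proof -
      have "J (z + complex_of_real t *\<^sub>C h) = J z + t\<^sup>2 * (norm h)\<^sup>2 + 2 * t * d"
        by (simp add: J_def d_def power2_norm_add add scale cinner_scaleC_right norm_scaleC
            power_mult_distrib algebra_simps)
      then show ?thesis using m_le[of "z + complex_of_real t *\<^sub>C h"] Jz by linarith
    qed
    \<comment> \<open>Adding 1 avoids a division by zero when \<open>h = 0\<close>. The trial value
      \<open>t = - d / s\<close> makes the quadratic negative unless \<open>d = 0\<close>.\<close>
    define s where "s = (norm h)\<^sup>2 + 1"
    have s: "s > 0" by (simp add: s_def add_nonneg_pos)
    have "0 \<le> (d / s)\<^sup>2 * (s - 1) + 2 * (- d / s) * d"
      using q[of "- d / s"] by (simp add: s_def)
    also have "\<dots> = - (d\<^sup>2 / s) * (1 + 1 / s)"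
      using s by (simp add: field_simps power2_eq_square)
    finally have "d\<^sup>2 / s * (1 + 1 / s) \<le> 0" by simp
    moreover have "1 + 1 / s > 0" using s by (simp add: add_pos_pos)
    ultimately have "d\<^sup>2 / s \<le> 0" unfolding mult_le_0_iff by linarith
    then have "d = 0" using s by (simp add: divide_le_0_iff)
    then show ?thesis by (simp add: d_def)
  qed
  \<comment> \<open>Real parts suffice: by complex linearity the real part at
    \<open>\<i> *\<^sub>C h\<close> is minus the imaginary part at \<open>h\<close>.\<close>
  have "f h = cinner z h" for h
    using re[of h] re[of "\<i> *\<^sub>C h"] by (simp add: complex_eq_iff scale cinner_scaleC_right)
  then show ?thesis by blast
qed

section \<open>Existence and algebra of adjoints\<close>

lemma app_op_add: "app_op A (x + y) = app_op A x + app_op A y"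
  using app_op[of A] by (simp add: bounded_linear.linear linear_add)

lemma app_op_scaleC: "app_op A (c *\<^sub>C x) = c *\<^sub>C app_op A x"
  using app_op[of A] by simp

lemma bop_eqI: "(\<And>x. app_op A x = app_op B x) \<Longrightarrow> A = B"
  using app_op_inject by (metis ext)

lemma app_op_bound: obtains K where "K \<ge> 0" "\<And>x. norm (app_op A x) \<le> K * norm x"
proof -
  have "bounded_linear (app_op A)" using app_op[of A] by simp
  then show ?thesis using that bounded_linear.nonneg_bounded by (metis mult.commute)
qed

lemma app_op_Bop:
  assumes "\<And>x y. f (x + y) = f x + f y" "\<And>c x. f (c *\<^sub>C x) = c *\<^sub>C f x"
    "\<And>x. norm (f x) \<le> K * norm x"
  shows "app_op (Bop f) = f"
proof (rule Bop_inverse, safe)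
  show "bounded_linear f"
    by (rule bounded_linear_intro[where K = K]) (auto simp: assms scaleR_scaleC mult.commute)
qed (fact assms)

text \<open>Nondegeneracy of the inner product makes the defining relation determine its solution,
  so exhibiting one operator that satisfies it evaluates the description in
  \<open>adj\<close>.\<close>

lemma adj_eqI:
  assumes "\<And>x y. cinner (app_op B x) y = cinner x (app_op A y)"
  shows "A\<^sup>\<star> = B"
  unfolding adj_def
proof (rule the_equality)
  fix C assume "\<forall>x y. cinner (app_op C x) y = cinner x (app_op A y)"
  then show "C = B" using assms by (intro bop_eqI cinner_left_eqI) simp
qed (use assms in blast)

text \<open>Existence of the adjoint. Riesz, applied for each \<open>x\<close> to the functional
  \<open>\<lambda>y. cinner x (app_op A y)\<close>, yields \<open>g x\<close>. Nondegeneracy makes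
  \<open>g\<close> linear, and testing the relation on \<open>g x\<close> itself shows that
  \<open>g\<close> inherits the bound \<open>K\<close> of \<open>A\<close>.\<close>

lemma cinner_adj_left: "cinner (app_op (A\<^sup>\<star>) x) y = cinner x (app_op A y)"
proof -
  obtain K where K: "K \<ge> 0" "\<And>x. norm (app_op A x) \<le> K * norm x" using app_op_bound[of A] by blast
  have "\<exists>z. \<forall>y. cinner x (app_op A y) = cinner z y" for x
  proof (rule riesz[where K = "norm x * K"])
    fix y
    have "cmod (cinner x (app_op A y)) \<le> norm x * norm (app_op A y)" by (rule norm_cinner_le)
    also have "\<dots> \<le> norm x * (K * norm y)" by (intro mult_left_mono K) simp
    finally show "cmod (cinner x (app_op A y)) \<le> norm x * K * norm y" by (simp add: mult.assoc)
  qed (auto simp: app_op_add app_op_scaleC cinner_add_right cinner_scaleC_right)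
  then obtain g where g: "cinner (g x) y = cinner x (app_op A y)" for x y by metis
  have "app_op (Bop g) = g"
  proof (rule app_op_Bop[where K = K])
    fix x
    have "(norm (g x))\<^sup>2 = cmod (cinner (g x) (g x))" by (simp add: cinner_self norm_power)
    also have "\<dots> = cmod (cinner x (app_op A (g x)))" by (simp add: g)
    also have "\<dots> \<le> norm x * norm (app_op A (g x))" by (rule norm_cinner_le)
    also have "\<dots> \<le> norm x * (K * norm (g x))" by (intro mult_left_mono K) simp
    finally have "norm (g x) * norm (g x) \<le> (K * norm x) * norm (g x)"
      by (simp add: power2_eq_square algebra_simps)
    then show "norm (g x) \<le> K * norm x"
      using K(1) by (cases "norm (g x) = 0") auto
  qed (rule cinner_left_eqI, simp add: g cinner_add_left cinner_add_right cinner_scaleC_left)+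
  then have "A\<^sup>\<star> = Bop g" by (intro adj_eqI) (simp add: g)
  then show ?thesis using g \<open>app_op (Bop g) = g\<close> by simp
qed

lemma cinner_adj_right: "cinner x (app_op (A\<^sup>\<star>) y) = cinner (app_op A x) y"
  by (metis cinner_adj_left cinner_commute)

lemma adj_add: "(A + B)\<^sup>\<star> = A\<^sup>\<star> + B\<^sup>\<star>"
  by (rule adj_eqI)
    (simp add: plus_bop.rep_eq cinner_add_left cinner_add_right cinner_adj_left)

lemma adj_scaleC: "(c *\<^sub>C A)\<^sup>\<star> = cnj c *\<^sub>C A\<^sup>\<star>"
  by (rule adj_eqI)
    (simp add: scaleC_bop.rep_eq cinner_scaleC_left cinner_scaleC_right cinner_adj_left)

lemma adj_mult: "(A * B)\<^sup>\<star> = B\<^sup>\<star> * A\<^sup>\<star>"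
  by (rule adj_eqI) (simp add: times_bop.rep_eq cinner_adj_left)

lemma adj_one [simp]: "1\<^sup>\<star> = 1"
  by (rule adj_eqI) (simp add: one_bop.rep_eq)

lemma adj_adj [simp]: "(A\<^sup>\<star>)\<^sup>\<star> = A"
  by (rule adj_eqI) (simp add: cinner_adj_right)

lemma adj_zero [simp]: "0\<^sup>\<star> = 0"
  by (rule adj_eqI) (simp add: zero_bop.rep_eq)

lemma scaleC_mult_left: "(c *\<^sub>C A) * B = c *\<^sub>C (A * B)" for A B :: "'a::complex_inner bop"
  by transfer simp

lemma scaleC_mult_right: "A * (c *\<^sub>C B) = c *\<^sub>C (A * B)" for A B :: "'a::complex_inner bop"
  by transfer simp


section \<open>Orthonormal sets in finite dimension\<close>

text \<open>Stated for sets, so that Gram-Schmidt can adjoin vectors without reindexing; the indexed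
  \<open>orthonormal_basis\<close> is recovered afterwards through lists.\<close>

definition orthonormal :: "'a::complex_inner set \<Rightarrow> bool" where
  "orthonormal S \<longleftrightarrow> (\<forall>x\<in>S. \<forall>y\<in>S. cinner x y = (if x = y then 1 else 0))"

lemma orthonormalD:
  "orthonormal S \<Longrightarrow> x \<in> S \<Longrightarrow> y \<in> S \<Longrightarrow> cinner x y = (if x = y then 1 else 0)"
  by (simp add: orthonormal_def)

lemma orthonormal_independent:
  assumes "orthonormal S"
  shows "\<not> cdependent S"
proof
  assume "cdependent S"
  then obtain T u v where T: "finite T" "T \<subseteq> S" "(\<Sum>v\<in>T. u v *\<^sub>C v) = 0" "v \<in> T" "u v \<noteq> 0"
    unfolding complex_vector.dependent_explicit by blast
  have "0 = cinner v (\<Sum>w\<in>T. u w *\<^sub>C w)" using T by simp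
  also have "\<dots> = (\<Sum>w\<in>T. if v = w then u w else 0)"
    unfolding cinner_sum_right cinner_scaleC_right
  proof (rule sum.cong)
    fix w assume "w \<in> T"
    then have "cinner v w = (if v = w then 1 else 0)"
      using T by (intro orthonormalD[OF assms]) auto
    then show "u w * cinner v w = (if v = w then u w else 0)" by simp
  qed simp
  also have "\<dots> = u v" using T by simp
  finally show False using T by simp
qed

text \<open>For finite orthonormal \<open>S\<close>, the component of \<open>x\<close> orthogonal to
  the span of \<open>S\<close>.\<close>

definition residual :: "'a::complex_inner set \<Rightarrow> 'a \<Rightarrow> 'a" where
  "residual S x = x - (\<Sum>b\<in>S. cinner b x *\<^sub>C b)"

lemma cinner_residual:
  assumes "orthonormal S" "finite S" "b \<in> S"
  shows "cinner b (residual S x) = 0"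
proof -
  have "(\<Sum>a\<in>S. cinner a x * cinner b a) = (\<Sum>a\<in>S. if b = a then cinner a x else 0)"
    by (intro sum.cong) (simp_all add: orthonormalD[OF assms(1,3)])
  also have "\<dots> = cinner b x" using assms by simp
  finally show ?thesis
    by (simp add: residual_def cinner_diff_right cinner_sum_right cinner_scaleC_right)
qed

lemma orthonormal_insert:
  assumes "orthonormal S" "cinner e e = 1" "\<And>b. b \<in> S \<Longrightarrow> cinner b e = 0"
  shows "e \<notin> S" "orthonormal (insert e S)"
proof -
  show "e \<notin> S" using assms(2) assms(3)[of e] by auto
  have "cinner e b = 0" if "b \<in> S" for b
    using assms(3)[OF that] cinner_commute[of e b] by simp
  then show "orthonormal (insert e S)"
    unfolding orthonormal_def using assms(2,3) \<open>e \<notin> S\<close> orthonormalD[OF assms(1)] by (metis insert_iff)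
qed

text \<open>One Gram-Schmidt step: a nonzero residual, divided by its length, is a unit vector that
  may be adjoined to \<open>S\<close>.\<close>

lemma normalized_residual:
  assumes "orthonormal S" "finite S" "residual S x \<noteq> 0"
  obtains e where "cinner e e = 1" "\<And>b. b \<in> S \<Longrightarrow> cinner b e = 0"
    "residual S x = complex_of_real (norm (residual S x)) *\<^sub>C e"
proof
  let ?r = "complex_of_real (norm (residual S x))"
  let ?e = "inverse ?r *\<^sub>C residual S x"
  show "cinner ?e ?e = 1"
    using assms(3)
    by (simp add: cinner_scaleC_left cinner_scaleC_right cinner_self[of "residual S x"]
        power2_eq_square field_simps)
  show "cinner b ?e = 0" if "b \<in> S" for b
    using cinner_residual[OF assms(1,2) that] by (simp add: cinner_scaleC_right)
  show "residual S x = ?r *\<^sub>C ?e"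
    using assms by (simp add: scaleC_scaleC scaleC_one)
qed

text \<open>Orthonormal sets are independent, so no larger than a finite spanning set. A basis
  \<open>B\<close> is used as that set because its cardinality is \<open>cdim\<close>; its own
  finiteness comes from \<open>G\<close>.\<close>

lemma orthonormal_card_le:
  assumes fd: "finite_dimensional TYPE('a::complex_inner)" and S: "orthonormal (S :: 'a set)"
  shows "finite S" "card S \<le> cdim (UNIV :: 'a set)"
proof -
  obtain G :: "'a set" where G: "finite G" "cspan G = UNIV"
    using fd by (auto simp: finite_dimensional_def)
  obtain B :: "'a set" where B: "\<not> cdependent B" "UNIV \<subseteq> cspan B" "card B = cdim (UNIV :: 'a set)"
    by (rule complex_vector.basis_exists[of UNIV])
  have "finite B"
    using complex_vector.independent_span_bound[OF G(1) B(1)] G(2) by simp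
  from complex_vector.independent_span_bound[OF this orthonormal_independent[OF S]]
  show "finite S" "card S \<le> cdim (UNIV :: 'a set)"
    using B(2,3) by auto
qed

text \<open>Otherwise the normalised residual of \<open>x\<close> could be adjoined to
  \<open>S\<close>, giving an orthonormal set with more elements than the dimension allows.\<close>

lemma orthonormal_expansion:
  assumes fd: "finite_dimensional TYPE('a::complex_inner)"
    and S: "orthonormal (S :: 'a set)" "card S = cdim (UNIV :: 'a set)"
  shows "x = (\<Sum>b\<in>S. cinner b x *\<^sub>C b)"
proof (rule ccontr)
  assume "x \<noteq> (\<Sum>b\<in>S. cinner b x *\<^sub>C b)"
  then have "residual S x \<noteq> 0" by (simp add: residual_def)
  moreover have fin: "finite S" using orthonormal_card_le[OF fd S(1)] by simp
  ultimately obtain e where e: "cinner e e = 1" "\<And>b. b \<in> S \<Longrightarrow> cinner b e = 0"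
    using normalized_residual[OF S(1)] by metis
  have "card (insert e S) \<le> cdim (UNIV :: 'a set)"
    using orthonormal_card_le[OF fd orthonormal_insert(2)[OF S(1) e]] by simp
  then show False using orthonormal_insert(1)[OF S(1) e] fin S(2) by simp
qed

text \<open>Induction on the number of missing vectors. If every residual vanished, \<open>S\<close>
  would span the space and could not be smaller than the dimension; so some residual can be
  normalised and adjoined.\<close>

lemma orthonormal_extend:
  assumes fd: "finite_dimensional TYPE('a::complex_inner)" and S: "orthonormal (S :: 'a set)"
  obtains T where "S \<subseteq> T" "orthonormal T" "card T = cdim (UNIV :: 'a set)"
proof -
  have "\<exists>T. S \<subseteq> T \<and> orthonormal T \<and> card T = cdim (UNIV :: 'a set)"
    using S
  proof (induction "cdim (UNIV :: 'a set) - card S" arbitrary: S)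
    case 0
    then show ?case using orthonormal_card_le[OF fd] by (metis diff_is_0_eq le_antisym order_refl)
  next
    case (Suc n)
    have fin: "finite S" using orthonormal_card_le[OF fd Suc.prems] by simp
    have "\<exists>x. residual S x \<noteq> 0"
    proof (rule ccontr)
      assume "\<nexists>x. residual S x \<noteq> 0"
      then have "(\<Sum>b\<in>S. cinner b x *\<^sub>C b) = x" for x by (simp add: residual_def)
      moreover have "(\<Sum>b\<in>S. cinner b x *\<^sub>C b) \<in> cspan S" for x
        by (intro complex_vector.span_sum complex_vector.span_scale complex_vector.span_base)
      ultimately have "x \<in> cspan S" for x by simp
      then have "cdim (UNIV :: 'a set) \<le> card S"
        by (intro complex_vector.dim_le_card fin) auto
      then show False using Suc.hyps(2) by simp
    qed
    then obtain x where "residual S x \<noteq> 0" by blast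
    then obtain e where e: "cinner e e = 1" "\<And>b. b \<in> S \<Longrightarrow> cinner b e = 0"
      using normalized_residual[OF Suc.prems fin] by metis
    note ins = orthonormal_insert[OF Suc.prems e]
    have "n = cdim (UNIV :: 'a set) - card (insert e S)"
      using Suc.hyps(2) ins fin by simp
    from Suc.hyps(1)[OF this ins(2)] show ?case by blast
  qed
  then show ?thesis using that by blast
qed

lemma orthonormal_basis_nth:
  assumes "distinct bs" "orthonormal (set bs)" "length bs = cdim (UNIV :: 'a::complex_inner set)"
  shows "orthonormal_basis (\<lambda>i. bs ! i :: 'a)"
  unfolding orthonormal_basis_def
  using orthonormalD[OF assms(2)] assms(1,3) by (simp add: nth_eq_iff_index_eq)

text \<open>The vectors of a completed set that are not in \<open>es\<close> are listed after
  \<open>es\<close>. The given list thus becomes an initial segment of an indexed basis, and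
  eigenvalues can later be assigned by position.\<close>

lemma orthonormal_list_extend:
  fixes es :: "'a::complex_inner list"
  assumes fd: "finite_dimensional TYPE('a)"
    and "distinct es" "orthonormal (set es)"
  obtains \<psi> :: "nat \<Rightarrow> 'a" where "orthonormal_basis \<psi>" "length es \<le> cdim (UNIV :: 'a set)"
    "map \<psi> [0..<length es] = es"
proof -
  obtain T where T: "set es \<subseteq> T" "orthonormal T" "card T = cdim (UNIV :: 'a set)"
    using orthonormal_extend[OF fd assms(3)] by blast
  then have "finite (T - set es)" using orthonormal_card_le[OF fd] by simp
  then obtain fs where fs: "set fs = T - set es" "distinct fs"
    using finite_distinct_list by blast
  have bs: "distinct (es @ fs)" "set (es @ fs) = T" using fs assms T by auto
  then have "length (es @ fs) = cdim (UNIV :: 'a set)"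
    using distinct_card[OF bs(1)] bs(2) T(3) by simp
  moreover from this have "orthonormal_basis (\<lambda>i. (es @ fs) ! i)"
    by (intro orthonormal_basis_nth) (use bs T in auto)
  ultimately show ?thesis
    by (intro that[of "\<lambda>i. (es @ fs) ! i"]) (auto intro: nth_equalityI simp: nth_append)
qed

lemma orthonormal_basis_exists:
  assumes "finite_dimensional TYPE('a::complex_inner)"
  shows "\<exists>\<psi> :: nat \<Rightarrow> 'a. orthonormal_basis \<psi>"
  using orthonormal_list_extend[OF assms, of "[]"] by (simp add: orthonormal_def) blast

lemma orthonormal_basis_expansion:
  assumes fd: "finite_dimensional TYPE('a::complex_inner)"
    and \<psi>: "orthonormal_basis (\<psi> :: nat \<Rightarrow> 'a)"
  shows "x = (\<Sum>j < cdim (UNIV :: 'a set). cinner (\<psi> j) x *\<^sub>C \<psi> j)"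
proof -
  let ?I = "{..<cdim (UNIV :: 'a set)}"
  \<comment> \<open>A vector occurring at two indices would have inner product both 0 and 1 with
    itself.\<close>
  have inj: "inj_on \<psi> ?I"
    using \<psi> unfolding inj_on_def orthonormal_basis_def by (metis lessThan_iff zero_neq_one)
  have "orthonormal (\<psi> ` ?I)"
    unfolding orthonormal_def
  proof (intro ballI)
    fix x y assume "x \<in> \<psi> ` ?I" "y \<in> \<psi> ` ?I"
    then obtain i j where "i \<in> ?I" "j \<in> ?I" "x = \<psi> i" "y = \<psi> j" by blast
    then show "cinner x y = (if x = y then 1 else 0)"
      using \<psi> inj_on_eq_iff[OF inj, of i j] by (simp add: orthonormal_basis_def)
  qed
  from orthonormal_expansion[OF fd this, of x] show ?thesis
    using inj by (simp add: card_image sum.reindex)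
qed


section \<open>Normal ordering\<close>

lemma adj_minus: "(- A)\<^sup>\<star> = - (A\<^sup>\<star>)" for A :: "'a::chilbert_space bop"
  using adj_add[of A "- A"] by (simp add: eq_neg_iff_add_eq_0 add.commute)

lemma adj_sum: "(\<Sum>i\<in>I. f i)\<^sup>\<star> = (\<Sum>i\<in>I. (f i)\<^sup>\<star>)" for f :: "'i \<Rightarrow> 'a::chilbert_space bop"
  by (induction I rule: infinite_finite_induct) (auto simp: adj_add)

lemma scaleC_2: "2 *\<^sub>C x = x + x" for x :: "'a::complex_vector"
  using scaleC_add_left[of 1 1 x] by (simp add: scaleC_one)

lemma eq_uminus_self: "x = - x \<Longrightarrow> x = 0" for x :: "'a::complex_vector"
  using complex_vector.scale_eq_0_iff[of 2 x] by (simp add: scaleC_2 eq_neg_iff_add_eq_0)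

text \<open>The map \<open>g\<close> on scalars covers both linear maps, with the identity, and the
  conjugate linear adjoint, with \<open>cnj\<close>.\<close>

lemma cspan_image:
  fixes f :: "'a::complex_vector \<Rightarrow> 'b::complex_vector"
  assumes add: "\<And>x y. f (x + y) = f x + f y"
    and scale: "\<And>c x. f (c *\<^sub>C x) = g c *\<^sub>C f x"
    and gen: "\<And>x. x \<in> S \<Longrightarrow> f x \<in> cspan T"
    and x: "x \<in> cspan S"
  shows "f x \<in> cspan T"
  using x
proof (induction rule: complex_vector.span_induct)
  case base
  have "f 0 = 0" using add[of 0 0] by simp
  then show ?case
    by (auto intro!: complex_vector.subspaceI
        simp: add scale complex_vector.span_zero complex_vector.span_add complex_vector.span_scale)
qed (rule gen)

text \<open>Eigenvectors for distinct eigenvalues are independent: subtracting \<open>l\<close>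
  times the relation from its image under \<open>D\<close> removes the term \<open>l\<close> and
  multiplies every other term by the nonzero number \<open>k - l\<close>, so the induction
  hypothesis applies to the rescaled eigenvectors.\<close>

lemma graded_sum_eq_0:
  fixes f :: "int \<Rightarrow> 'a::complex_vector"
  assumes "finite I" and D_add: "\<And>x y. D (x + y) = D x + D y"
    and D_scale: "\<And>c x. D (c *\<^sub>C x) = c *\<^sub>C D x"
    and eigen: "\<And>k. k \<in> I \<Longrightarrow> D (f k) = of_int k *\<^sub>C f k"
    and "(\<Sum>k\<in>I. f k) = 0" and "k \<in> I"
  shows "f k = 0"
  using assms(1,4-6)
proof (induction I arbitrary: f k rule: finite_induct)
  case (insert l I)
  have D_0: "D 0 = 0" using D_add[of 0 0] by simp
  have D_sum: "D (\<Sum>k\<in>J. f k) = (\<Sum>k\<in>J. D (f k))" for J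
    by (induction J rule: infinite_finite_induct) (auto simp: D_0 D_add)
  have l: "f l = - (\<Sum>k\<in>I. f k)"
    using insert.prems(2) insert.hyps by (simp add: eq_neg_iff_add_eq_0)
  have "0 = D (\<Sum>k\<in>insert l I. f k)" using insert.prems(2) D_0 by simp
  also have "\<dots> = (\<Sum>k\<in>insert l I. of_int k *\<^sub>C f k)"
    unfolding D_sum by (intro sum.cong insert.prems(1)) auto
  also have "\<dots> = of_int l *\<^sub>C f l + (\<Sum>k\<in>I. of_int k *\<^sub>C f k)"
    using insert.hyps by simp
  also have "\<dots> = (\<Sum>k\<in>I. of_int (k - l) *\<^sub>C f k)"
    by (simp add: l complex_vector.scale_sum_right complex_vector.scale_left_diff_distrib
        sum_subtractf)
  finally have sum0: "(\<Sum>k\<in>I. of_int (k - l) *\<^sub>C f k) = 0" by simp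
  have "D (of_int (j - l) *\<^sub>C f j) = of_int j *\<^sub>C of_int (j - l) *\<^sub>C f j" if "j \<in> I" for j
    using insert.prems(1)[of j] that by (simp add: D_scale scaleC_scaleC mult.commute)
  from insert.IH[of "\<lambda>j. of_int (j - l) *\<^sub>C f j", OF this sum0]
  have "of_int (j - l) *\<^sub>C f j = 0" if "j \<in> I" for j using that by blast
  then have "f j = 0" if "j \<in> I" for j
    using that insert.hyps by (auto simp: complex_vector.scale_eq_0_iff)
  then show ?case using l insert.prems(3) by auto
qed simp

locale car =
  fixes Z :: "'h::chilbert_space \<Rightarrow> 'k::chilbert_space bop"
  assumes CAR: "CAR_field Z"
begin

lemma Z_add: "Z (v + w) = Z v + Z w"
  using CAR by (simp add: CAR_field_def)

lemma Z_scaleC: "Z (c *\<^sub>C v) = cnj c *\<^sub>C Z v"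
  using CAR by (simp add: CAR_field_def)

lemma Z_star: "Z v * (Z w)\<^sup>\<star> = cinner v w *\<^sub>C 1 - (Z w)\<^sup>\<star> * Z v"
  using CAR by (simp add: CAR_field_def eq_diff_eq)

lemma Z_anticommute: "Z v * Z w = - (Z w * Z v)"
  using CAR by (simp add: CAR_field_def eq_neg_iff_add_eq_0)

lemma star_anticommute: "(Z v)\<^sup>\<star> * (Z w)\<^sup>\<star> = - ((Z w)\<^sup>\<star> * (Z v)\<^sup>\<star>)"
  using arg_cong[OF Z_anticommute[of w v], of adj] by (simp add: adj_mult adj_minus)

lemma star_square: "(Z v)\<^sup>\<star> * (Z v)\<^sup>\<star> = 0"
  using star_anticommute eq_uminus_self by blast

lemma Z_zero: "Z 0 = 0"
  using Z_add[of 0 0] by simp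

lemma Z_sum: "Z (\<Sum>i\<in>I. f i) = (\<Sum>i\<in>I. Z (f i))"
  by (induction I rule: infinite_finite_induct) (auto simp: Z_zero Z_add)

section \<open>Normally ordered monomials and their grading\<close>

definition stars :: "'h list \<Rightarrow> 'k bop" where
  "stars vs = prod_list (map (\<lambda>v. (Z v)\<^sup>\<star>) vs)"

definition anns :: "'h list \<Rightarrow> 'k bop" where
  "anns ws = prod_list (map Z ws)"

lemma stars_simps [simp]: "stars [] = 1" "stars (v # vs) = (Z v)\<^sup>\<star> * stars vs"
    "stars (vs @ vs') = stars vs * stars vs'"
  and anns_simps [simp]: "anns [] = 1" "anns (w # ws) = Z w * anns ws"
    "anns (ws @ ws') = anns ws * anns ws'"
  by (simp_all add: stars_def anns_def)

lemma adj_stars: "(stars vs)\<^sup>\<star> = anns (rev vs)"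
  by (induction vs) (auto simp: adj_mult)

lemma adj_anns: "(anns ws)\<^sup>\<star> = stars (rev ws)"
  by (induction ws) (auto simp: adj_mult)

definition monomials :: "int \<Rightarrow> 'k bop set" where
  "monomials k = {stars vs * anns ws |vs ws. int (length vs) - int (length ws) = k}"

definition graded :: "int \<Rightarrow> 'k bop set" where
  "graded k = cspan (monomials k)"

lemma monomialsI: "int (length vs) - int (length ws) = k \<Longrightarrow> stars vs * anns ws \<in> monomials k"
  by (auto simp: monomials_def)

lemma monomials_graded: "x \<in> monomials k \<Longrightarrow> x \<in> graded k"
  unfolding graded_def by (rule complex_vector.span_base)

lemma star_mult_graded: "X \<in> graded k \<Longrightarrow> (Z v)\<^sup>\<star> * X \<in> graded (k + 1)"
  unfolding graded_def
proof (rule cspan_image[where f = "\<lambda>X. (Z v)\<^sup>\<star> * X" and g = "\<lambda>c. c"])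
  fix x assume "x \<in> monomials k"
  then obtain vs ws where x: "x = stars vs * anns ws" "int (length vs) - int (length ws) = k"
    by (auto simp: monomials_def)
  have "stars (v # vs) * anns ws \<in> monomials (k + 1)" using x by (intro monomialsI) auto
  then show "(Z v)\<^sup>\<star> * x \<in> cspan (monomials (k + 1))"
    using x by (auto intro!: complex_vector.span_base simp: mult.assoc)
qed (auto simp: distrib_left scaleC_mult_right)

text \<open>By the CAR, moving \<open>Z w\<close> to the right past a creator changes the sign and
  adds a scalar term in which both have disappeared. Either way the degree falls by one in
  comparison with the monomial.\<close>

lemma Z_mult_monomial:
  "Z w * (stars vs * anns ws) \<in> graded (int (length vs) - int (length ws) - 1)"
proof (induction vs)
  case Nil
  show ?case
    using monomialsI[of "[]" "w # ws" "- int (length ws) - 1"] by (auto intro!: monomials_graded)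
next
  case (Cons v vs)
  have "Z w * (stars (v # vs) * anns ws) = (Z w * (Z v)\<^sup>\<star>) * (stars vs * anns ws)"
    by (simp add: mult.assoc)
  also have "\<dots> = cinner w v *\<^sub>C (stars vs * anns ws) - (Z v)\<^sup>\<star> * (Z w * (stars vs * anns ws))"
    by (simp add: Z_star left_diff_distrib scaleC_mult_left mult.assoc)
  also have "\<dots> \<in> graded (int (length vs) - int (length ws))"
    using star_mult_graded[OF Cons.IH, of v] monomials_graded[OF monomialsI[OF refl, of vs ws]]
    unfolding graded_def by (auto intro!: complex_vector.span_diff complex_vector.span_scale)
  finally show ?case by simp
qed

lemma Z_mult_graded: "X \<in> graded k \<Longrightarrow> Z w * X \<in> graded (k - 1)"
  unfolding graded_def
  by (rule cspan_image[where f = "\<lambda>X. Z w * X" and g = "\<lambda>c. c"])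
    (use Z_mult_monomial in \<open>auto simp: distrib_left scaleC_mult_right monomials_def graded_def\<close>)

definition normal_ordered :: "'k bop set" where
  "normal_ordered = cspan (\<Union>k. monomials k)"

lemma graded_subset: "graded k \<subseteq> normal_ordered"
  unfolding graded_def normal_ordered_def by (intro complex_vector.span_mono) auto

lemma normal_ordered_mult_left:
  assumes "\<And>k x. x \<in> monomials k \<Longrightarrow> A * x \<in> normal_ordered" and "X \<in> normal_ordered"
  shows "A * X \<in> normal_ordered"
  using assms(2) unfolding normal_ordered_def
  by (rule cspan_image[where f = "\<lambda>X. A * X" and g = "\<lambda>c. c", rotated 3])
    (use assms(1) in \<open>auto simp: distrib_left scaleC_mult_right normal_ordered_def\<close>)

lemma star_mult_normal_ordered: "X \<in> normal_ordered \<Longrightarrow> (Z v)\<^sup>\<star> * X \<in> normal_ordered"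
  by (rule normal_ordered_mult_left) (use monomials_graded star_mult_graded graded_subset in blast)+

lemma Z_mult_normal_ordered: "X \<in> normal_ordered \<Longrightarrow> Z v * X \<in> normal_ordered"
  by (rule normal_ordered_mult_left) (use monomials_graded Z_mult_graded graded_subset in blast)+

text \<open>Left multiplication by a creator or an annihilator preserves the span, so a monomial is
  multiplied onto \<open>Y\<close> one factor at a time, from its right end.\<close>

lemma normal_ordered_mult:
  assumes X: "X \<in> normal_ordered" and Y: "Y \<in> normal_ordered"
  shows "X * Y \<in> normal_ordered"
  using X unfolding normal_ordered_def
proof (rule cspan_image[where f = "\<lambda>X. X * Y" and g = "\<lambda>c. c", rotated 3])
  fix x assume "x \<in> (\<Union>k. monomials k)"
  then obtain vs ws where x: "x = stars vs * anns ws" by (auto simp: monomials_def)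
  have "anns ws * Y \<in> normal_ordered"
    by (induction ws) (auto simp: Y mult.assoc Z_mult_normal_ordered)
  then have "stars vs * (anns ws * Y) \<in> normal_ordered"
    by (induction vs) (auto simp: mult.assoc star_mult_normal_ordered)
  then show "x * Y \<in> cspan (\<Union>k. monomials k)"
    by (simp add: x mult.assoc normal_ordered_def)
qed (auto simp: distrib_right scaleC_mult_left)

text \<open>The adjoint exchanges the two blocks of a monomial and reverses each, so normal order
  survives. The degree changes sign, which the union over all \<open>k\<close> absorbs.\<close>

lemma adj_normal_ordered:
  assumes "X \<in> normal_ordered"
  shows "X\<^sup>\<star> \<in> normal_ordered"
  using assms unfolding normal_ordered_def
proof (rule cspan_image[where f = adj and g = cnj, rotated 3])
  fix x assume "x \<in> (\<Union>k. monomials k)"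
  then obtain vs ws where x: "x = stars vs * anns ws" by (auto simp: monomials_def)
  then show "x\<^sup>\<star> \<in> cspan (\<Union>k. monomials k)"
    using monomialsI[OF refl, of "rev ws" "rev vs"]
    by (auto intro!: complex_vector.span_base simp: adj_mult adj_stars adj_anns)
qed (auto simp: adj_add adj_scaleC)

lemma CAR_algebra_normal_ordered:
  assumes "X \<in> CAR_algebra Z"
  shows "X \<in> normal_ordered"
  using assms unfolding CAR_algebra_def
proof (induction rule: star_algebra.induct)
  case (generator A)
  then obtain v where "A = stars [] * anns [v]" by auto
  then show ?case using monomialsI[of "[]" "[v]" "-1"] monomials_graded graded_subset by auto
next
  case one
  have "1 = stars [] * anns []" by simp
  then show ?case using monomialsI[of "[]" "[]" 0] monomials_graded graded_subset by auto
next
  case (add A B)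
  then show ?case by (simp add: normal_ordered_def complex_vector.span_add)
next
  case (scale A c)
  then show ?case by (simp add: normal_ordered_def complex_vector.span_scale)
qed (auto intro: normal_ordered_mult adj_normal_ordered)

lemma normal_ordered_decompose:
  assumes "X \<in> normal_ordered"
  obtains I f where "finite I" "\<And>k. f k \<in> graded k" "X = (\<Sum>k\<in>I. f k)"
proof -
  \<comment> \<open>The vanishing of \<open>f\<close> outside \<open>I\<close> is carried through
    the induction because the new degree \<open>l\<close> may or may not already belong to
    \<open>I\<close>.\<close>
  have "\<exists>I f. finite I \<and> (\<forall>k. f k \<in> graded k) \<and> (\<forall>k. k \<notin> I \<longrightarrow> f k = 0) \<and> X = (\<Sum>k\<in>I. f k)"
    using assms unfolding normal_ordered_def
  proof (induction rule: complex_vector.span_induct_alt)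
    case base
    show ?case
      by (intro exI[of _ "{}"] exI[of _ "\<lambda>_. 0"]) (auto simp: graded_def complex_vector.span_zero)
  next
    case (step c x y)
    then obtain I f l where I: "finite I" "\<forall>k. f k \<in> graded k" "\<forall>k. k \<notin> I \<longrightarrow> f k = 0"
      "y = (\<Sum>k\<in>I. f k)" and x: "x \<in> monomials l" by blast
    let ?f = "\<lambda>k. (if k = l then c *\<^sub>C x else 0) + f k"
    have "(\<Sum>k\<in>insert l I. f k) = y"
      unfolding I(4) using I by (intro sum.mono_neutral_right) auto
    then have "c *\<^sub>C x + y = (\<Sum>k\<in>insert l I. ?f k)"
      using I(1) by (simp add: sum.distrib del: sum.insert)
    moreover have "?f k \<in> graded k" for k
      using I(2) monomials_graded[OF x] unfolding graded_def
      by (auto intro!: complex_vector.span_add complex_vector.span_scale)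
    ultimately show ?case
      using I by (intro exI[of _ "insert l I"] exI[of _ ?f]) auto
  qed
  then show ?thesis using that by blast
qed

end


section \<open>Diagonal monomials and Gaussian states\<close>

lemma positive_diagonal:
  assumes "\<And>x. app_op A x = (\<Sum>j\<in>J. (complex_of_real (r j) * cinner (\<psi> j) x) *\<^sub>C \<psi> j)"
    and "\<And>j. j \<in> J \<Longrightarrow> r j \<ge> 0"
  shows "positive_op A"
  unfolding positive_op_def
proof
  fix x
  have "cinner x (app_op A x) = (\<Sum>j\<in>J. complex_of_real (r j * (cmod (cinner (\<psi> j) x))\<^sup>2))"
    unfolding assms(1) cinner_sum_right cinner_scaleC_right
  proof (intro sum.cong refl)
    fix j
    have "cinner (\<psi> j) x * cinner x (\<psi> j) = complex_of_real ((cmod (cinner (\<psi> j) x))\<^sup>2)"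
      using cinner_commute[of x "\<psi> j"] complex_norm_square[of "cinner (\<psi> j) x"] by simp
    then show "complex_of_real (r j) * cinner (\<psi> j) x * cinner x (\<psi> j) =
        complex_of_real (r j * (cmod (cinner (\<psi> j) x))\<^sup>2)"
      by (simp add: mult.assoc)
  qed
  then have "cinner x (app_op A x) = complex_of_real (\<Sum>j\<in>J. r j * (cmod (cinner (\<psi> j) x))\<^sup>2)"
    by simp
  moreover have "(\<Sum>j\<in>J. r j * (cmod (cinner (\<psi> j) x))\<^sup>2) \<ge> 0"
    using assms(2) by (intro sum_nonneg) auto
  ultimately show "cinner x (app_op A x) \<in> \<real>\<^sub>\<ge>\<^sub>0"
    by (simp only: nonneg_Reals_of_real_iff)
qed

text \<open>The operator is built from its diagonal form. Since the basis resolves the identity,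
  \<open>1 - Q\<close> is diagonal in the same basis with eigenvalues \<open>1 - \<mu> j\<close>,
  and both operators are positive.\<close>

lemma symbol_exists:
  assumes fd: "finite_dimensional TYPE('h::chilbert_space)"
    and \<psi>: "orthonormal_basis (\<psi> :: nat \<Rightarrow> 'h)"
    and \<mu>: "\<And>j. 0 \<le> \<mu> j \<and> \<mu> j \<le> 1"
  shows "\<exists>Q \<in> symbols. spectral_decomposition Q \<mu> \<psi>"
proof -
  let ?J = "{..<cdim (UNIV :: 'h set)}"
  define f where "f x = (\<Sum>j\<in>?J. (complex_of_real (\<mu> j) * cinner (\<psi> j) x) *\<^sub>C \<psi> j)" for x
  have Q: "app_op (Bop f) = f"
  proof (rule app_op_Bop[where K = "\<Sum>j\<in>?J. norm (\<psi> j) * norm (\<psi> j)"])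
    fix x
    have "norm (f x) \<le> (\<Sum>j\<in>?J. norm ((complex_of_real (\<mu> j) * cinner (\<psi> j) x) *\<^sub>C \<psi> j))"
      unfolding f_def by (rule norm_sum)
    also have "\<dots> \<le> (\<Sum>j\<in>?J. norm (\<psi> j) * norm (\<psi> j) * norm x)"
    proof (intro sum_mono)
      fix j
      have "\<mu> j * cmod (cinner (\<psi> j) x) \<le> 1 * (norm (\<psi> j) * norm x)"
        using \<mu>[of j] by (intro mult_mono norm_cinner_le) auto
      then have "\<mu> j * cmod (cinner (\<psi> j) x) * norm (\<psi> j) \<le> norm (\<psi> j) * norm x * norm (\<psi> j)"
        by (intro mult_right_mono) auto
      then show "norm ((complex_of_real (\<mu> j) * cinner (\<psi> j) x) *\<^sub>C \<psi> j)
          \<le> norm (\<psi> j) * norm (\<psi> j) * norm x"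
        using \<mu>[of j] by (simp add: norm_scaleC norm_mult mult_ac)
    qed
    finally show "norm (f x) \<le> (\<Sum>j\<in>?J. norm (\<psi> j) * norm (\<psi> j)) * norm x"
      by (simp add: sum_distrib_right)
  qed (simp_all add: f_def cinner_add_right cinner_scaleC_right distrib_left scaleC_add_left
      sum.distrib complex_vector.scale_sum_right scaleC_scaleC mult_ac)
  have "positive_op (Bop f)"
    by (rule positive_diagonal[where J = ?J and r = \<mu> and \<psi> = \<psi>]) (use \<mu> in \<open>auto simp: Q f_def\<close>)
  moreover have "positive_op (1 - Bop f)"
  proof (rule positive_diagonal[where J = ?J and r = "\<lambda>j. 1 - \<mu> j" and \<psi> = \<psi>])
    fix x
    have "app_op (1 - Bop f) x = (\<Sum>j\<in>?J. cinner (\<psi> j) x *\<^sub>C \<psi> j) - f x"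
      using orthonormal_basis_expansion[OF fd \<psi>, of x]
      by (simp add: minus_bop.rep_eq one_bop.rep_eq Q)
    then show "app_op (1 - Bop f) x =
        (\<Sum>j\<in>?J. (complex_of_real (1 - \<mu> j) * cinner (\<psi> j) x) *\<^sub>C \<psi> j)"
      by (simp add: f_def left_diff_distrib complex_vector.scale_left_diff_distrib sum_subtractf)
  qed (use \<mu> in auto)
  ultimately have "Bop f \<in> symbols" by (simp add: symbols_def)
  moreover have "spectral_decomposition (Bop f) \<mu> \<psi>"
    using \<psi> by (simp add: spectral_decomposition_def Q f_def)
  ultimately show ?thesis by blast
qed

context car
begin

section \<open>The number operator and the degree of its commutant\<close>

abbreviation number :: "'k bop" where
  "number \<equiv> number_operator Z"

text \<open>Each summand of the number operator contributes the creator of one component of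
  \<open>v\<close> in the basis, and these add up to the creator of \<open>v\<close>.\<close>

lemma number_star:
  assumes fd: "finite_dimensional TYPE('h)"
  shows "number * (Z v)\<^sup>\<star> = (Z v)\<^sup>\<star> * number + (Z v)\<^sup>\<star>"
proof -
  let ?J = "{..<cdim (UNIV :: 'h set)}"
  obtain \<psi> :: "nat \<Rightarrow> 'h" where \<psi>: "orthonormal_basis \<psi>"
    and N: "number = (\<Sum>j\<in>?J. (Z (\<psi> j))\<^sup>\<star> * Z (\<psi> j))"
    using someI_ex[OF orthonormal_basis_exists[OF fd]] by (simp add: number_operator_def Let_def)
  \<comment> \<open>The scalar is absorbed into the argument, creators being linear in it, so that
    the sum over \<open>j\<close> becomes the creator of the expansion of \<open>v\<close>.\<close>
  have "(Z (\<psi> j))\<^sup>\<star> * Z (\<psi> j) * (Z v)\<^sup>\<star> =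
      (Z v)\<^sup>\<star> * ((Z (\<psi> j))\<^sup>\<star> * Z (\<psi> j)) + (Z (cinner (\<psi> j) v *\<^sub>C \<psi> j))\<^sup>\<star>" for j
  proof -
    have "(Z (\<psi> j))\<^sup>\<star> * Z (\<psi> j) * (Z v)\<^sup>\<star> =
        cinner (\<psi> j) v *\<^sub>C (Z (\<psi> j))\<^sup>\<star> - (Z (\<psi> j))\<^sup>\<star> * (Z v)\<^sup>\<star> * Z (\<psi> j)"
      by (simp add: mult.assoc Z_star right_diff_distrib scaleC_mult_right)
    then show ?thesis
      by (simp add: star_anticommute[of "\<psi> j" v] mult.assoc Z_scaleC adj_scaleC)
  qed
  then have "number * (Z v)\<^sup>\<star> =
      (Z v)\<^sup>\<star> * number + (Z (\<Sum>j\<in>?J. cinner (\<psi> j) v *\<^sub>C \<psi> j))\<^sup>\<star>"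
    by (simp add: N sum_distrib_left sum_distrib_right sum.distrib Z_sum adj_sum)
  then show ?thesis
    using orthonormal_basis_expansion[OF fd \<psi>, of v] by simp
qed

lemma number_Z:
  assumes fd: "finite_dimensional TYPE('h)"
  shows "number * Z v = Z v * number - Z v"
proof -
  have "number\<^sup>\<star> = number"
    by (simp add: number_operator_def Let_def adj_sum adj_mult)
  then show ?thesis
    using arg_cong[OF number_star[OF fd, of v], of adj] by (simp add: adj_mult adj_add)
qed

text \<open>Commuting \<open>number\<close> through a monomial adds one copy of it for every creator
  passed and subtracts one for every annihilator.\<close>

lemma commutator_graded:
  assumes fd: "finite_dimensional TYPE('h)" and "X \<in> graded k"
  shows "number * X - X * number = of_int k *\<^sub>C X"
  using assms(2) unfolding graded_def
proof (induction rule: complex_vector.span_induct)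
  case base
  show ?case
    by (auto intro!: complex_vector.subspaceI simp: distrib_left distrib_right scaleC_add_right
        scaleC_mult_left scaleC_mult_right add_diff_add scaleC_scaleC mult.commute
        simp flip: complex_vector.scale_right_diff_distrib)
next
  case (step x)
  then obtain vs ws where x: "x = stars vs * anns ws" "int (length vs) - int (length ws) = k"
    by (auto simp: monomials_def)
  have stars: "number * stars vs = stars vs * number + of_nat (length vs) *\<^sub>C stars vs"
  proof (induction vs)
    case (Cons v vs)
    have "number * stars (v # vs) = (number * (Z v)\<^sup>\<star>) * stars vs" by (simp add: mult.assoc)
    also have "\<dots> = (Z v)\<^sup>\<star> * (number * stars vs) + (Z v)\<^sup>\<star> * stars vs"
      by (simp add: number_star[OF fd] distrib_right mult.assoc)
    finally show ?case
      by (simp add: Cons.IH distrib_left scaleC_mult_right mult.assoc scaleC_add_left scaleC_one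
          add_ac)
  qed simp
  have anns: "number * anns ws = anns ws * number - of_nat (length ws) *\<^sub>C anns ws"
  proof (induction ws)
    case (Cons w ws)
    have "number * anns (w # ws) = (number * Z w) * anns ws" by (simp add: mult.assoc)
    also have "\<dots> = Z w * (number * anns ws) - Z w * anns ws"
      by (simp add: number_Z[OF fd] left_diff_distrib mult.assoc)
    finally show ?case
      by (simp add: Cons.IH right_diff_distrib scaleC_mult_right mult.assoc scaleC_add_left
          scaleC_one algebra_simps)
  qed simp
  have "number * x = stars vs * (number * anns ws) + of_nat (length vs) *\<^sub>C x"
    by (simp add: x(1) stars distrib_right scaleC_mult_left flip: mult.assoc)
  also have "\<dots> = x * number + (of_nat (length vs) *\<^sub>C x - of_nat (length ws) *\<^sub>C x)"
    by (simp add: x(1) anns right_diff_distrib scaleC_mult_right mult.assoc algebra_simps)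
  also have "of_nat (length vs) *\<^sub>C x - of_nat (length ws) *\<^sub>C x = of_int k *\<^sub>C x"
    unfolding complex_vector.scale_left_diff_distrib[symmetric] x(2)[symmetric] by simp
  finally show ?case by simp
qed

lemma araki_wyss_graded:
  assumes fd: "finite_dimensional TYPE('h)" and A: "A \<in> araki_wyss Z"
  shows "A \<in> graded 0"
proof -
  define D where "D X = number * X - X * number" for X
  have D_add: "D (X + Y) = D X + D Y" and D_scale: "D (c *\<^sub>C X) = c *\<^sub>C D X" for X Y c
    by (simp_all add: D_def distrib_left distrib_right scaleC_mult_left scaleC_mult_right
        complex_vector.scale_right_diff_distrib)
  have "A \<in> normal_ordered" "D A = 0"
    using A CAR_algebra_normal_ordered by (auto simp: araki_wyss_def D_def)
  then obtain I f where If: "finite I" "\<And>k. f k \<in> graded k" "A = (\<Sum>k\<in>I. f k)"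
    using normal_ordered_decompose by metis
  have eigen: "D (f k) = of_int k *\<^sub>C f k" for k
    unfolding D_def using commutator_graded[OF fd If(2)] .
  have D_0: "D 0 = 0" by (simp add: D_def)
  have "D (\<Sum>k\<in>J. f k) = (\<Sum>k\<in>J. of_int k *\<^sub>C f k)" for J
    by (induction J rule: infinite_finite_induct) (auto simp: D_0 D_add eigen)
  \<comment> \<open>The \<open>f k\<close> sum to \<open>A\<close>, but their images under
    \<open>D\<close> sum to zero. Independence is therefore applied to the vectors
    \<open>of_int k *\<^sub>C f k\<close>, which leaves only degree 0.\<close>
  then have "(\<Sum>k\<in>I. of_int k *\<^sub>C f k) = 0" using If(3) \<open>D A = 0\<close> by simp
  moreover have "D (of_int k *\<^sub>C f k) = of_int k *\<^sub>C of_int k *\<^sub>C f k" for k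
    by (simp add: D_scale eigen)
  ultimately have "of_int k *\<^sub>C f k = 0" if "k \<in> I" for k
    using graded_sum_eq_0[of I D "\<lambda>k. of_int k *\<^sub>C f k", OF If(1) D_add D_scale] that by blast
  then have "k = 0 \<or> f k = 0" if "k \<in> I" for k
    using that by (simp add: complex_vector.scale_eq_0_iff)
  moreover have "0 \<in> graded 0" by (simp add: graded_def complex_vector.span_zero)
  ultimately have "f k \<in> graded 0" if "k \<in> I" for k
    using that If(2) by metis
  then show ?thesis
    unfolding If(3) graded_def by (rule complex_vector.span_sum)
qed

section \<open>Polarisation and orthonormalisation of monomials of degree 0\<close>

text \<open>The nested form of a monomial of degree 0: the first pair is outermost. It allows one
  pair to be altered while everything around and inside it stays fixed.\<close>

definition sandwich :: "('h \<times> 'h) list \<Rightarrow> 'k bop \<Rightarrow> 'k bop" where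
  "sandwich ps X = foldr (\<lambda>(v, w) X. (Z v)\<^sup>\<star> * X * Z w) ps X"

lemma sandwich_simps [simp]:
  "sandwich [] X = X"
  "sandwich ((v, w) # ps) X = (Z v)\<^sup>\<star> * sandwich ps X * Z w"
  "sandwich (ps @ qs) X = sandwich ps (sandwich qs X)"
  by (simp_all add: sandwich_def)

lemma sandwich_add: "sandwich ps (X + Y) = sandwich ps X + sandwich ps Y"
  by (induction ps) (auto simp: distrib_left distrib_right)

lemma sandwich_scaleC: "sandwich ps (c *\<^sub>C X) = c *\<^sub>C sandwich ps X"
  by (induction ps) (auto simp: scaleC_mult_left scaleC_mult_right)

lemma sandwich_eq: "sandwich ps X = stars (map fst ps) * X * anns (rev (map snd ps))"
  by (induction ps) (auto simp: mult.assoc)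

text \<open>In degree 0 there are as many creators as annihilators. Nesting pairs the creators from
  the left with the annihilators from the right, hence \<open>rev ws\<close>.\<close>

lemma graded_0_sandwich:
  assumes "csubspace S" and "\<And>ps. sandwich ps 1 \<in> S"
  shows "graded 0 \<subseteq> S"
  unfolding graded_def
proof (rule complex_vector.span_minimal[OF _ assms(1)], rule subsetI)
  fix x assume "x \<in> monomials 0"
  then obtain vs ws where x: "x = stars vs * anns ws" "length vs = length ws"
    by (auto simp: monomials_def)
  then have "x = sandwich (zip vs (rev ws)) 1" by (simp add: sandwich_eq)
  then show "x \<in> S" using assms(2) by simp
qed

abbreviation diag :: "'h list \<Rightarrow> ('h \<times> 'h) list" where
  "diag vs \<equiv> map (\<lambda>v. (v, v)) vs"

text \<open>The expression is linear in \<open>v\<close> and conjugate linear in \<open>w\<close>.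
  Expand it on the diagonal at \<open>v + z *\<^sub>C w\<close>, weight by \<open>z\<close> and sum
  over the fourth roots of unity: the sums of \<open>z\<close> and of \<open>z * z\<close> vanish,
  that of \<open>z * cnj z\<close> is 4, so only the wanted cross term remains.\<close>

lemma sandwich_polarization:
  "4 *\<^sub>C ((Z v)\<^sup>\<star> * X * Z w) =
    (Z (v + w))\<^sup>\<star> * X * Z (v + w) + (-1) *\<^sub>C ((Z (v + (-1) *\<^sub>C w))\<^sup>\<star> * X * Z (v + (-1) *\<^sub>C w))
    + \<i> *\<^sub>C ((Z (v + \<i> *\<^sub>C w))\<^sup>\<star> * X * Z (v + \<i> *\<^sub>C w))
    + (-\<i>) *\<^sub>C ((Z (v + (-\<i>) *\<^sub>C w))\<^sup>\<star> * X * Z (v + (-\<i>) *\<^sub>C w))"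
proof -
  define a where "a = (Z v)\<^sup>\<star> * X * Z v"
  define b where "b = (Z v)\<^sup>\<star> * X * Z w"
  define c where "c = (Z w)\<^sup>\<star> * X * Z v"
  define d where "d = (Z w)\<^sup>\<star> * X * Z w"
  have q: "(Z (v + z *\<^sub>C w))\<^sup>\<star> * X * Z (v + z *\<^sub>C w) =
      a + cnj z *\<^sub>C b + z *\<^sub>C c + (z * cnj z) *\<^sub>C d" for z
    by (simp add: Z_add Z_scaleC adj_add adj_scaleC distrib_left distrib_right scaleC_mult_left
        scaleC_mult_right scaleC_scaleC scaleC_add_right a_def b_def c_def d_def add_ac mult.commute)
  have four: "4 *\<^sub>C b = b + b + b + b"
    using scaleC_add_left[of 2 2 b] by (simp add: scaleC_2)
  show ?thesis
    unfolding q q[of 1, unfolded scaleC_one] b_def[symmetric] four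
    by (simp add: scaleC_add_right complex_vector.scale_right_diff_distrib scaleC_scaleC scaleC_one)
qed

text \<open>Polarisation one pair at a time, from the outside in: \<open>us\<close> holds the pairs
  already made diagonal and grows by one at each step.\<close>

lemma sandwich_in_subspace:
  assumes S: "csubspace S" and diag: "\<And>vs. sandwich (diag vs) 1 \<in> S"
  shows "sandwich (diag us @ ps) 1 \<in> S"
proof (induction ps arbitrary: us)
  case Nil
  show ?case using diag by simp
next
  case (Cons p ps)
  obtain v w where p: "p = (v, w)" by fastforce
  have *: "sandwich (diag us) ((Z u)\<^sup>\<star> * sandwich ps 1 * Z u) \<in> S" for u
    using Cons.IH[of "us @ [u]"] by simp
  have "4 *\<^sub>C sandwich (diag us @ p # ps) 1 \<in> S"
    unfolding p sandwich_simps sandwich_scaleC[symmetric] sandwich_polarization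
    unfolding sandwich_add sandwich_scaleC
    by (intro complex_vector.subspace_add[OF S] complex_vector.subspace_scale[OF S] *)
  then have "inverse 4 *\<^sub>C 4 *\<^sub>C sandwich (diag us @ p # ps) 1 \<in> S"
    by (rule complex_vector.subspace_scale[OF S])
  then show ?case by (simp add: scaleC_scaleC scaleC_one)
qed

text \<open>The creator anticommutes inwards until it meets its own copy, and the square of a
  creator is zero.\<close>

lemma star_mult_sandwich_eq_0: "v \<in> set vs \<Longrightarrow> (Z v)\<^sup>\<star> * sandwich (diag vs) 1 = 0"
proof (induction vs)
  case (Cons u vs)
  have "(Z v)\<^sup>\<star> * sandwich (diag (u # vs)) 1 = ((Z v)\<^sup>\<star> * (Z u)\<^sup>\<star>) * sandwich (diag vs) 1 * Z u"
    by (simp add: mult.assoc)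
  moreover have "\<dots> = - ((Z u)\<^sup>\<star> * ((Z v)\<^sup>\<star> * sandwich (diag vs) 1) * Z u)"
    by (subst star_anticommute) (simp add: mult.assoc)
  ultimately show ?case using Cons star_square by auto
qed simp

lemma adj_sandwich_diag: "(sandwich (diag vs) 1)\<^sup>\<star> = sandwich (diag vs) 1"
  by (induction vs) (auto simp: adj_mult mult.assoc)

lemma sandwich_mult_Z_eq_0: "v \<in> set vs \<Longrightarrow> sandwich (diag vs) 1 * Z v = 0"
  using arg_cong[OF star_mult_sandwich_eq_0[of v vs], of adj]
  by (simp add: adj_mult adj_sandwich_diag)

text \<open>Gram-Schmidt: since \<open>Z(v)\<^sup>*\<close> and \<open>Z(v)\<close> annihilate a diagonal sandwich over vectors including
  \<open>v\<close>, subtracting from the outermost vector its projection onto the others changes nothing.\<close>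

lemma sandwich_orthonormal:
  "\<exists>es c. distinct es \<and> orthonormal (set es) \<and> sandwich (diag vs) 1 = c *\<^sub>C sandwich (diag es) 1"
proof (induction vs)
  case Nil
  show ?case by (intro exI[of _ "[]"] exI[of _ 1]) (simp add: orthonormal_def scaleC_one)
next
  case (Cons v vs)
  then obtain es c where es: "distinct es" "orthonormal (set es)"
    and c: "sandwich (diag vs) 1 = c *\<^sub>C sandwich (diag es) 1" by blast
  let ?X = "sandwich (diag es) 1" and ?u = "residual (set es) v"
  let ?p = "\<Sum>b\<in>set es. cinner b v *\<^sub>C b"
  have v: "v = ?u + ?p" by (simp add: residual_def)
  have "(Z ?p)\<^sup>\<star> * ?X = 0"
    by (simp add: Z_sum adj_sum sum_distrib_right Z_scaleC adj_scaleC scaleC_mult_left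
        star_mult_sandwich_eq_0)
  moreover have "?X * Z ?p = 0"
    by (simp add: Z_sum sum_distrib_left Z_scaleC scaleC_mult_right sandwich_mult_Z_eq_0)
  ultimately have "(Z v)\<^sup>\<star> * ?X * Z v = (Z ?u)\<^sup>\<star> * ?X * Z ?u"
    by (subst (1 2) v) (simp add: Z_add adj_add distrib_left distrib_right mult.assoc)
  then have eq: "sandwich (diag (v # vs)) 1 = c *\<^sub>C ((Z ?u)\<^sup>\<star> * ?X * Z ?u)"
    by (simp add: c scaleC_mult_left scaleC_mult_right)
  show ?case
  proof (cases "?u = 0")
    case True
    \<comment> \<open>Here \<open>v\<close> lies in the span of \<open>es\<close> and the sandwich
      vanishes; the coefficient 0 lets \<open>es\<close> stay as it is.\<close>
    then show ?thesis
      using es eq by (intro exI[of _ es] exI[of _ 0]) (simp add: Z_zero)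
  next
    case False
    then obtain e where e: "cinner e e = 1" "\<And>b. b \<in> set es \<Longrightarrow> cinner b e = 0"
      and u: "?u = complex_of_real (norm ?u) *\<^sub>C e"
      using normalized_residual[OF es(2)] by auto
    \<comment> \<open>One factor \<open>norm ?u\<close> comes out on each side; being real, it is
      unaffected by conjugation.\<close>
    have "(Z ?u)\<^sup>\<star> * ?X * Z ?u = complex_of_real ((norm ?u)\<^sup>2) *\<^sub>C sandwich (diag (e # es)) 1"
      by (subst (1 2) u) (simp add: Z_scaleC adj_scaleC scaleC_mult_left scaleC_mult_right
          scaleC_scaleC power2_eq_square)
    then show ?thesis
      using es eq orthonormal_insert[OF es(2) e]
      by (intro exI[of _ "e # es"] exI[of _ "c * complex_of_real ((norm ?u)\<^sup>2)"])
        (simp add: scaleC_scaleC)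
  qed
qed

text \<open>Passing one pair costs two signs, which cancel: one from the annihilator
  \<open>Z e\<close>, one from its adjoint, where orthogonality removes the scalar term of the
  CAR.\<close>

lemma sandwich_commute_orthogonal:
  assumes "\<And>e. e \<in> set es \<Longrightarrow> cinner v e = 0"
  shows "sandwich (diag es) 1 * Z v = Z v * sandwich (diag es) 1"
  using assms
proof (induction es)
  case (Cons e es)
  let ?X = "sandwich (diag es) 1"
  have "sandwich (diag (e # es)) 1 * Z v = (Z e)\<^sup>\<star> * (?X * (Z e * Z v))"
    by (simp add: mult.assoc)
  also have "\<dots> = - ((Z e)\<^sup>\<star> * ((?X * Z v) * Z e))"
    by (subst Z_anticommute) (simp add: mult.assoc)
  also have "\<dots> = - ((Z e)\<^sup>\<star> * Z v) * ?X * Z e"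
    using Cons by (simp add: mult.assoc)
  also have "- ((Z e)\<^sup>\<star> * Z v) = Z v * (Z e)\<^sup>\<star>"
    using Cons.prems[of e] by (simp add: Z_star)
  finally show ?case by (simp add: mult.assoc)
qed simp

text \<open>The annihilator at the right end commutes with the inner sandwich, since its vector is
  orthogonal to the others, and so moves next to its own creator.\<close>

lemma sandwich_orthonormal_eq_prod:
  assumes "distinct es" "orthonormal (set es)"
  shows "sandwich (diag es) 1 = prod_list (map (\<lambda>e. (Z e)\<^sup>\<star> * Z e) es)"
  using assms
proof (induction es)
  case (Cons e es)
  have "sandwich (diag es) 1 * Z e = Z e * sandwich (diag es) 1"
    using Cons.prems by (intro sandwich_commute_orthogonal) (auto simp: orthonormal_def)
  moreover have "orthonormal (set es)"
    using Cons.prems(2) by (simp add: orthonormal_def)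
  ultimately show ?case
    using Cons by (simp add: mult.assoc)
qed simp

section \<open>Orthonormal sandwiches as multiples of Gaussian densities\<close>

lemma prod_list_scaleC:
  "prod_list (map (\<lambda>x. c *\<^sub>C f x) xs) = c ^ length xs *\<^sub>C prod_list (map f xs)"
  for f :: "'i \<Rightarrow> 'a::complex_inner bop"
  by (induction xs) (auto simp: scaleC_one scaleC_mult_left scaleC_mult_right scaleC_scaleC)

text \<open>A factor of the density with \<open>\<mu> = 1/2\<close> is the identity, one with \<open>\<mu> = 1\<close> is
  \<open>2 Z(\<psi>)\<^sup>* Z(\<psi>)\<close>.\<close>

lemma sandwich_orthonormal_in_span_GIG:
  assumes fd: "finite_dimensional TYPE('h)" and es: "distinct es" "orthonormal (set es)"
  shows "sandwich (diag es) 1 \<in> cspan (GIG_states Z)"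
proof -
  let ?n = "cdim (UNIV :: 'h set)" and ?m = "length es"
  obtain \<psi> :: "nat \<Rightarrow> 'h" where \<psi>: "orthonormal_basis \<psi>" "?m \<le> ?n" "map \<psi> [0..<?m] = es"
    using orthonormal_list_extend[OF fd es] by blast
  define \<mu> :: "nat \<Rightarrow> real" where "\<mu> j = (if j < ?m then 1 else 1/2)" for j
  let ?f = "\<lambda>j. complex_of_real ((1 - \<mu> j) * 2) *\<^sub>C (Z (\<psi> j) * (Z (\<psi> j))\<^sup>\<star>) +
        complex_of_real (\<mu> j * 2) *\<^sub>C ((Z (\<psi> j))\<^sup>\<star> * Z (\<psi> j))"
  have "map ?f [0..<?m] = map (\<lambda>j. 2 *\<^sub>C ((Z (\<psi> j))\<^sup>\<star> * Z (\<psi> j))) [0..<?m]"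
    by (intro map_cong) (auto simp: \<mu>_def)
  also have "\<dots> = map (\<lambda>e. 2 *\<^sub>C ((Z e)\<^sup>\<star> * Z e)) (map \<psi> [0..<?m])" by simp
  finally have low: "map ?f [0..<?m] = map (\<lambda>e. 2 *\<^sub>C ((Z e)\<^sup>\<star> * Z e)) es" using \<psi>(3) by simp
  \<comment> \<open>At \<open>\<mu> j = 1/2\<close> both coefficients are 1, and the factor is the
    anticommutator belonging to the unit vector \<open>\<psi> j\<close>.\<close>
  have "map ?f [?m..<?n] = map (\<lambda>_. 1) [?m..<?n]"
  proof (intro map_cong refl)
    fix j assume "j \<in> set [?m..<?n]"
    then show "?f j = 1"
      using \<psi>(1) by (simp add: \<mu>_def orthonormal_basis_def scaleC_one Z_star)
  qed
  moreover have "prod_list (map (\<lambda>_. 1 :: 'k bop) js) = 1" for js :: "nat list"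
    by (induction js) auto
  moreover have "[0..<?n] = [0..<?m] @ [?m..<?n]"
    using upt_add_eq_append[of 0 ?m "?n - ?m"] \<psi>(2) by simp
  ultimately have "gaussian_density Z \<mu> \<psi> = 2 ^ ?m *\<^sub>C sandwich (diag es) 1"
    unfolding gaussian_density_def
    by (simp only: map_append prod_list.append low prod_list_scaleC
        sandwich_orthonormal_eq_prod[OF es] mult_1_right)
  then have "sandwich (diag es) 1 = inverse (2 ^ ?m) *\<^sub>C gaussian_density Z \<mu> \<psi>"
    by (simp add: scaleC_scaleC scaleC_one)
  moreover have "\<exists>Q \<in> symbols. spectral_decomposition Q \<mu> \<psi>"
    by (rule symbol_exists[OF fd \<psi>(1)]) (simp add: \<mu>_def)
  then have "gaussian_density Z \<mu> \<psi> \<in> GIG_states Z"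
    unfolding GIG_states_def by blast
  ultimately show ?thesis
    by (simp add: complex_vector.span_scale complex_vector.span_base)
qed

lemma graded_0_subset_span_GIG:
  assumes "finite_dimensional TYPE('h)"
  shows "graded 0 \<subseteq> cspan (GIG_states Z)"
proof (rule graded_0_sandwich)
  have "sandwich (diag vs) 1 \<in> cspan (GIG_states Z)" for vs
    using sandwich_orthonormal[of vs] sandwich_orthonormal_in_span_GIG[OF assms]
    by (metis complex_vector.span_scale)
  then show "sandwich ps 1 \<in> cspan (GIG_states Z)" for ps
    using sandwich_in_subspace[of "cspan (GIG_states Z)" "[]" ps] by simp
qed simp

section \<open>Gaussian densities lie in the Araki-Wyss algebra\<close>

lemma csubspace_araki_wyss: "csubspace (araki_wyss Z)"
proof (rule complex_vector.subspaceI)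
  \<comment> \<open>Zero is not among the introduction rules of \<open>star_algebra\<close>; it
    enters as a multiple of the identity.\<close>
  have "0 = 0 *\<^sub>C (1 :: 'k bop)" by simp
  then have "0 \<in> CAR_algebra Z"
    unfolding CAR_algebra_def by (metis star_algebra.one star_algebra.scale)
  then show "0 \<in> araki_wyss Z" by (simp add: araki_wyss_def)
qed (auto simp: araki_wyss_def CAR_algebra_def star_algebra.add star_algebra.scale distrib_left
    distrib_right scaleC_mult_left scaleC_mult_right)

lemma araki_wyss_mult: "A \<in> araki_wyss Z \<Longrightarrow> B \<in> araki_wyss Z \<Longrightarrow> A * B \<in> araki_wyss Z"
  unfolding araki_wyss_def CAR_algebra_def
  by (auto intro: star_algebra.mult) (metis mult.assoc)

text \<open>In a product of one creator and one annihilator the two shifts produced by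
  \<open>number\<close> cancel, so every factor of a Gaussian density commutes with it.\<close>

lemma GIG_subset_araki_wyss:
  assumes fd: "finite_dimensional TYPE('h)"
  shows "GIG_states Z \<subseteq> araki_wyss Z"
proof -
  have alg: "Z v \<in> CAR_algebra Z" "(Z v)\<^sup>\<star> \<in> CAR_algebra Z" for v
    unfolding CAR_algebra_def by (auto intro: star_algebra.intros)
  \<comment> \<open>The trailing factor \<open>X\<close> makes the relations applicable inside
    products bracketed to the right.\<close>
  have c: "Z v * (number * X) = number * (Z v * X) + Z v * X"
    "(Z v)\<^sup>\<star> * (number * X) = number * ((Z v)\<^sup>\<star> * X) - (Z v)\<^sup>\<star> * X" for v X
    by (simp_all add: number_Z[OF fd] number_star[OF fd] distrib_right left_diff_distrib
        flip: mult.assoc)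
  have pairs: "Z v * (Z v)\<^sup>\<star> \<in> araki_wyss Z" "(Z v)\<^sup>\<star> * Z v \<in> araki_wyss Z" for v
    using c[of v "1"] c[of v "Z v"] c[of v "(Z v)\<^sup>\<star>"] alg
    by (auto simp: araki_wyss_def CAR_algebra_def mult.assoc right_diff_distrib distrib_left
        intro: star_algebra.mult)
  have "1 \<in> araki_wyss Z"
    by (simp add: araki_wyss_def CAR_algebra_def star_algebra.one)
  then have prod: "prod_list xs \<in> araki_wyss Z" if "set xs \<subseteq> araki_wyss Z" for xs
    using that by (induction xs) (auto intro: araki_wyss_mult)
  have "gaussian_density Z \<mu> \<psi> \<in> araki_wyss Z" for \<mu> \<psi>
    unfolding gaussian_density_def
  proof (rule prod, unfold set_map, rule image_subsetI)
    fix j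
    show "complex_of_real ((1 - \<mu> j) * 2) *\<^sub>C (Z (\<psi> j) * (Z (\<psi> j))\<^sup>\<star>) +
        complex_of_real (\<mu> j * 2) *\<^sub>C ((Z (\<psi> j))\<^sup>\<star> * Z (\<psi> j)) \<in> araki_wyss Z"
      by (intro complex_vector.subspace_add[OF csubspace_araki_wyss]
          complex_vector.subspace_scale[OF csubspace_araki_wyss] pairs)
  qed
  then show ?thesis by (auto simp: GIG_states_def)
qed

lemma span_GIG_eq_araki_wyss:
  assumes "finite_dimensional TYPE('h)"
  shows "cspan (GIG_states Z) = araki_wyss Z"
  using complex_vector.span_minimal[OF GIG_subset_araki_wyss[OF assms] csubspace_araki_wyss]
    araki_wyss_graded[OF assms] graded_0_subset_span_GIG[OF assms] by blast

end

theorem theorem1p9: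
  fixes Z :: "'h::chilbert_space \<Rightarrow> 'k::chilbert_space bop"
  assumes "finite_dimensional TYPE('h)"
    and "CAR_field Z"
    and "acts_irreducibly Z"
  shows "cspan (GIG_states Z) = araki_wyss Z"
  by (intro car.span_GIG_eq_araki_wyss car.intro assms)

end
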